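(* Let $d\ge3$ and let $\mathbf{X}$ be a subordinate Brownian motion on $\mathbb{R}^d$ with Lévy–Khintchine exponent $\psi(x)=\varphi(|x|^2)$, where $\varphi$ is a Bernstein function with $\varphi(0)=0$, no drift, and whose Lévy measure $\mu$ has a non-increasing density. The following are equivalent: (i) there exist $\theta\ge0$, $\alpha>0$ and $\overline{c}\ge1$ such that $\varphi'\in\mathrm{WUSC}(-\alpha,\theta,\overline{c})$; (ii) there exist $C>0$ and $\theta>0$ such that for all $t>0$ and $x\in\mathbb{R}^d$ with $t\varphi(|x|^{-2})\le1$ and $0<|x|<\theta^{-1}$, $p(t,x)\ge C\,t|x|^{-d-2}\varphi'(|x|^{-2})$; (iii) there exist $C>0$ and $\theta>0$ such that for $0<|x|<\theta^{-1}$, $\nu(x)\ge C|x|^{-d-2}\varphi'(|x|^{-2})$.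
   Context: A Bernstein function here is $\varphi(u)=\int_{(0,\infty)}(1-e^{-us})\,\mu(\mathrm{d}s)$ with $\int\min\{1,s\}\mu(\mathrm{d}s)<\infty$; it is the Laplace exponent of a subordinator $(T_t)$, and $X_t=B_{T_t}$ with $\mathbf{B}$ an independent Brownian motion on $\mathbb{R}^d$ normalized so that $\mathbb{E}e^{i\langle\xi,X_t\rangle}=e^{-t\varphi(|\xi|^2)}$. Its Lévy measure has the radial non-increasing density $\nu(x)=\int_0^\infty(4\pi s)^{-d/2}e^{-|x|^2/(4s)}\mu(\mathrm{d}s)$, and $p(t,x)$ denotes the density of $X_t$. A function $f$ belongs to $\mathrm{WUSC}(\beta,x_0,C)$ (weak upper scaling at infinity) if $f(\lambda x)\le C\lambda^\beta f(x)$ for all $\lambda\ge1$ and $x>x_0$. *)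

theory Defs
  imports "HOL-Probability.Probability"
begin

text \<open>Bernstein function without drift and killing, whose Levy measure
  has density m on (0,infinity): phi(u) = integral over (0,inf) of (1 - exp(-u s)) m(s) ds.\<close>
definition bernstein_phi :: "(real \<Rightarrow> real) \<Rightarrow> real \<Rightarrow> real" where
  "bernstein_phi m u = (LINT s:{0<..}|lborel. (1 - exp (- u * s)) * m s)"

text \<open>Heat kernel normalised so that E exp(i<xi,B_s>) = exp(-s |xi|^2).\<close>
definition heat_kernel :: "nat \<Rightarrow> real \<Rightarrow> real \<Rightarrow> real" where
  "heat_kernel d s r = (4 * pi * s) powr (- real d / 2) * exp (- r\<^sup>2 / (4 * s))"

definition sbm_levy_density :: "nat \<Rightarrow> (real \<Rightarrow> real) \<Rightarrow> 'a::euclidean_space \<Rightarrow> real" where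
  "sbm_levy_density d m x = (LINT s:{0<..}|lborel. heat_kernel d s (norm x) * m s)"

text \<open>Transition density of X_t = B_{T_t} (for x \<noteq> 0), where eta t is the law of T_t.\<close>
definition sbm_density :: "nat \<Rightarrow> (real \<Rightarrow> real measure) \<Rightarrow> real \<Rightarrow> 'a::euclidean_space \<Rightarrow> real" where
  "sbm_density d eta t x = (LINT s:{0<..}|eta t. heat_kernel d s (norm x))"

definition WUSC :: "(real \<Rightarrow> real) \<Rightarrow> real \<Rightarrow> real \<Rightarrow> real \<Rightarrow> bool" where
  "WUSC f b x0 C \<longleftrightarrow> (\<forall>l\<ge>1. \<forall>x>x0. f (l * x) \<le> C * l powr b * f x)"

end

theory Submission
  imports Defs "HOL-Real_Asymp.Real_Asymp"
begin

text \<open>Write \<open>\<phi>'(u) = \<integral> s exp (- u s) m(s) ds\<close> and \<open>r = |x|\<close>. Under (i), the part of the integral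
  \<open>\<integral> s exp (- u s) eta t (ds) = t \<phi>'(u) exp (- t \<phi>(u))\<close> coming from \<open>s\<close> comparable to
  \<open>1 / u = r\<^sup>2\<close> is at least a constant times \<open>t \<phi>'(u)\<close>, and there the heat kernel is comparable to
  \<open>r\<^sup>-\<^sup>d\<close>; this gives (ii). Since \<open>p(t,x) / t\<close> tends to \<open>\<nu>(x)\<close> as \<open>t\<close> tends to \<open>0\<close>,
  (ii) implies (iii). Finally, \<open>\<nu>(x)\<close> is at most
  \<open>\<epsilon> r\<^sup>-\<^sup>d\<^sup>-\<^sup>2 \<phi>'(r\<^sup>-\<^sup>2) + K r\<^sup>2\<^sup>-\<^sup>d m(\<delta> r\<^sup>2)\<close> (the tail integral converges because \<open>d \<ge> 3\<close>), so (iii)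
  forces \<open>m(\<delta> / u) \<ge> c u\<^sup>2 \<phi>'(u)\<close> for large \<open>u\<close>. By monotonicity of \<open>m\<close> this makes
  \<open>\<phi>'(u) - \<phi>'(2u)\<close> at least a fixed fraction of \<open>\<phi>'(u)\<close>, and iterating gives (i).\<close>

section \<open>Laplace exponents\<close>

text \<open>A mean value estimate, obtained from \<open>1 - exp (- x) \<le> x\<close> after ordering
  \<open>u\<close> and \<open>v\<close>. Divided by \<open>\<bar>u - v\<bar>\<close> it dominates
  the difference quotients of the Laplace exponent.\<close>

lemma abs_exp_diff_le:
  fixes u v s c :: real
  assumes "0 \<le> s" "c \<le> u" "c \<le> v"
  shows "\<bar>exp (- u * s) - exp (- v * s)\<bar> \<le> \<bar>u - v\<bar> * (s * exp (- c * s))"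
  using assms(2,3)
proof (induction u v rule: linorder_wlog)
  case (le u v)
  have "exp (- u * s) - exp (- v * s) = exp (- u * s) * (1 - exp (- ((v - u) * s)))"
    by (simp add: algebra_simps flip: exp_add)
  also have "\<dots> \<le> exp (- c * s) * ((v - u) * s)"
    using le \<open>0 \<le> s\<close> exp_ge_add_one_self[of "- ((v - u) * s)"]
    by (intro mult_mono) (auto simp: mult_right_mono)
  finally have "exp (- u * s) - exp (- v * s) \<le> exp (- c * s) * ((v - u) * s)" .
  moreover have "exp (- v * s) \<le> exp (- u * s)"
    using le \<open>0 \<le> s\<close> by (simp add: mult_right_mono)
  ultimately show ?case using le by (simp add: mult_ac)
next
  case (sym u v)
  then show ?case by (simp add: abs_minus_commute)
qed

text \<open>For \<open>s \<le> 1\<close> the exponential is dropped; for \<open>s > 1\<close> the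
  bound \<open>x * exp (- x) \<le> 1\<close> at \<open>x = w * s\<close> is used. It compares the
  integrand of the derivative with the Levy weight \<open>min 1 s\<close>.\<close>

lemma mult_exp_minus_le_min:
  fixes s w :: real
  assumes "0 \<le> s" "0 < w"
  shows "s * exp (- w * s) \<le> max 1 (1 / w) * min 1 s"
proof -
  have "w * s * exp (- w * s) \<le> exp (w * s) * exp (- w * s)"
    using exp_ge_add_one_self[of "w * s"] by (intro mult_right_mono) (linarith, simp)
  then have "w * (s * exp (- w * s)) \<le> 1"
    by (simp flip: exp_add add: mult.assoc)
  then have 1: "s * exp (- w * s) \<le> 1 / w"
    using assms by (simp add: field_simps)
  have 2: "s * exp (- w * s) \<le> s"
    using mult_left_mono[of "exp (- w * s)" 1 s] assms by simp
  show ?thesis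
  proof (cases "s \<le> 1")
    case True
    have "s \<le> max 1 (1 / w) * s"
      using assms by (simp add: mult_le_cancel_right1)
    with 2 True show ?thesis by (simp add: min_def)
  next
    case False
    with 1 show ?thesis by (simp add: min_def max_def)
  qed
qed

text \<open>Kept general in order to serve twice: for the Levy measure, where \<open>lexp\<close> is
  the Bernstein function, and for each law \<open>eta t\<close>, where \<open>lexp u\<close> is one
  minus the Laplace transform. An atom at 0, which \<open>eta t\<close> may have, is compatible with
  the assumptions.\<close>

locale half_line_levy =
  fixes M :: "real measure"
  assumes sets_M [measurable_cong]: "sets M = sets borel"
    and AE_nonneg: "AE s in M. 0 \<le> s"
    and integrable_min: "integrable M (\<lambda>s. min 1 s)"
begin

definition lexp :: "real \<Rightarrow> real" where
  "lexp u = (\<integral>s. (1 - exp (- u * s)) \<partial>M)"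

definition dlexp :: "real \<Rightarrow> real" where
  "dlexp u = (\<integral>s. s * exp (- u * s) \<partial>M)"

lemma integrable_one_minus_exp:
  assumes "0 \<le> u"
  shows "integrable M (\<lambda>s. 1 - exp (- u * s))"
proof (rule Bochner_Integration.integrable_bound)
  show "integrable M (\<lambda>s. max 1 u * min 1 s)"
    using integrable_min by simp
  show "AE s in M. norm (1 - exp (- u * s)) \<le> norm (max 1 u * min 1 s)"
    using AE_nonneg
  proof eventually_elim
    case (elim s)
    have "1 - exp (- u * s) \<le> u * s"
      using exp_ge_add_one_self[of "- u * s"] by simp
    also have "u * s \<le> max 1 u * s"
      using elim by (intro mult_right_mono) auto
    finally have 1: "1 - exp (- u * s) \<le> max 1 u * s" .
    have 2: "1 - exp (- u * s) \<le> max 1 u * 1"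
      by (smt (verit) exp_gt_zero max.cobounded1)
    have "1 - exp (- u * s) \<le> max 1 u * min 1 s"
      using 1 2 by (simp add: min_def)
    moreover have "0 \<le> u * s" using elim assms by simp
    ultimately show ?case using elim by (simp add: abs_mult)
  qed
qed measurable

lemma integrable_mult_exp:
  assumes "0 < u"
  shows "integrable M (\<lambda>s. s * exp (- u * s))"
proof (rule Bochner_Integration.integrable_bound)
  show "integrable M (\<lambda>s. max 1 (1 / u) * min 1 s)"
    using integrable_min by simp
  show "AE s in M. norm (s * exp (- u * s)) \<le> norm (max 1 (1 / u) * min 1 s)"
    using AE_nonneg
  proof eventually_elim
    case (elim s)
    then show ?case using mult_exp_minus_le_min[OF elim assms] by (simp add: abs_mult)
  qed
qed measurable

text \<open>Dominated convergence along sequences. The approaching points stay above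
  \<open>u / 2\<close>, so the single integrable function \<open>s * exp (- (u / 2) * s)\<close>
  dominates all difference quotients.\<close>

lemma DERIV_lexp:
  assumes "0 < u"
  shows "(lexp has_real_derivative dlexp u) (at u)"
proof -
  have "((\<lambda>y. (lexp y - lexp u) / (y - u)) \<longlongrightarrow> dlexp u) (at u within {u/2<..})"
    unfolding tendsto_at_iff_sequentially
  proof (intro allI impI)
    fix X :: "nat \<Rightarrow> real"
    assume X: "\<forall>i. X i \<in> {u/2<..} - {u}" and lim: "X \<longlonglongrightarrow> u"
    have Xp: "X i > u / 2" "X i \<noteq> u" for i using X by auto
    have Xp': "X i > 0" for i using Xp[of i] assms by simp
    define q where "q i s = ((1 - exp (- X i * s)) - (1 - exp (- u * s))) / (X i - u)" for i s
    have "(\<lambda>i. integral\<^sup>L M (q i)) \<longlonglongrightarrow> (\<integral>s. s * exp (- u * s) \<partial>M)"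
    proof (rule integral_dominated_convergence)
      show "integrable M (\<lambda>s. s * exp (- (u / 2) * s))"
        using assms by (intro integrable_mult_exp) auto
      show "AE s in M. (\<lambda>i. q i s) \<longlonglongrightarrow> s * exp (- u * s)"
      proof (rule AE_I2)
        fix s
        have "((\<lambda>y. 1 - exp (- y * s)) has_real_derivative s * exp (- u * s)) (at u)"
          by (auto intro!: derivative_eq_intros)
        then have "((\<lambda>y. ((1 - exp (- y * s)) - (1 - exp (- u * s))) / (y - u)) \<longlongrightarrow> s * exp (- u * s)) (at u)"
          by (simp add: has_field_derivative_iff)
        then show "(\<lambda>i. q i s) \<longlonglongrightarrow> s * exp (- u * s)"
          unfolding q_def using lim Xp
          by (simp add: tendsto_at_iff_sequentially comp_def)
      qed
      show "AE s in M. norm (q i s) \<le> s * exp (- (u / 2) * s)" for i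
        using AE_nonneg
      proof eventually_elim
        case (elim s)
        have "\<bar>exp (- u * s) - exp (- X i * s)\<bar> \<le> \<bar>u - X i\<bar> * (s * exp (- (u / 2) * s))"
          using Xp[of i] assms elim by (intro abs_exp_diff_le) auto
        then show ?case using Xp[of i] unfolding q_def
          by (simp add: field_simps abs_minus_commute)
      qed
      show "q i \<in> borel_measurable M" for i
        unfolding q_def by measurable
    qed measurable
    moreover have "integral\<^sup>L M (q i) = (lexp (X i) - lexp u) / (X i - u)" for i
      unfolding q_def lexp_def using assms Xp'[of i]
      by (subst Bochner_Integration.integral_diff [OF integrable_one_minus_exp integrable_one_minus_exp, symmetric])
         (auto simp del: Bochner_Integration.integral_diff)
    ultimately show "((\<lambda>y. (lexp y - lexp u) / (y - u)) \<circ> X) \<longlonglongrightarrow> dlexp u"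
      by (simp add: comp_def dlexp_def)
  qed
  then show ?thesis
    using assms by (simp add: has_field_derivative_iff at_within_open[of u "{u/2<..}"])
qed

lemma deriv_lexp: "0 < u \<Longrightarrow> deriv lexp u = dlexp u"
  by (rule DERIV_imp_deriv[OF DERIV_lexp])

lemma dlexp_nonneg: "0 \<le> dlexp u"
  unfolding dlexp_def using AE_nonneg by (intro integral_nonneg_AE) auto

lemma lexp_nonneg:
  assumes "0 \<le> u"
  shows "0 \<le> lexp u"
  unfolding lexp_def using AE_nonneg
proof (intro integral_nonneg_AE, eventually_elim)
  case (elim s)
  then have "0 \<le> u * s" using assms by simp
  then show ?case by simp
qed

lemma dlexp_antimono:
  assumes "0 < u" "u \<le> v"
  shows "dlexp v \<le> dlexp u"
  unfolding dlexp_def using AE_nonneg assms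
  by (intro integral_mono_AE integrable_mult_exp) (auto elim!: eventually_mono intro!: mult_left_mono mult_right_mono)

section \<open>Localising the integral \<open>dlexp u\<close> to \<open>s\<close> of order
  \<open>1 / u\<close>\<close>

lemma integrable_indicator_mult_exp:
  assumes "0 < u" "A \<in> sets borel"
  shows "integrable M (\<lambda>s. indicator A s * (s * exp (- u * s)))"
  using integrable_real_mult_indicator[OF _ integrable_mult_exp[OF assms(1)], of A] assms(2) sets_M
  by (simp add: mult.commute)

text \<open>On \<open>s < a / u\<close> the exponent \<open>(u / a) * s\<close> is at most 1, so
  raising the parameter from \<open>u\<close> to \<open>u / a\<close> costs at most a factor
  \<open>exp 1\<close>.\<close>

lemma integral_low_le:
  assumes "0 < u" "0 < a" "a \<le> 1"
  shows "(\<integral>s. indicator {..<a / u} s * (s * exp (- u * s)) \<partial>M) \<le> exp 1 * dlexp (u / a)"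
proof -
  have "(\<integral>s. indicator {..<a / u} s * (s * exp (- u * s)) \<partial>M)
        \<le> (\<integral>s. exp 1 * (s * exp (- (u / a) * s)) \<partial>M)"
  proof (rule integral_mono_AE)
    show "AE s in M. indicator {..<a / u} s * (s * exp (- u * s)) \<le> exp 1 * (s * exp (- (u / a) * s))"
      using AE_nonneg
    proof eventually_elim
      case (elim s)
      show ?case
      proof (cases "s < a / u")
        case True
        then have "u / a * s \<le> 1" using assms by (simp add: field_simps)
        moreover have "0 \<le> u * s" using assms elim by simp
        ultimately have "- u * s \<le> 1 + (- (u / a) * s)" by simp
        then have "exp (- u * s) \<le> exp 1 * exp (- (u / a) * s)"
          by (simp only: exp_le_cancel_iff flip: exp_add)
        then show ?thesis
          using True elim by (simp add: mult_left_mono mult.left_commute)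
      qed (use elim in auto)
    qed
    show "integrable M (\<lambda>s. indicator {..<a / u} s * (s * exp (- u * s)))"
      using assms by (intro integrable_indicator_mult_exp) auto
    show "integrable M (\<lambda>s. exp 1 * (s * exp (- (u / a) * s)))"
      using integrable_mult_exp[of "u / a"] assms by simp
  qed
  then show ?thesis by (simp add: dlexp_def)
qed

text \<open>On \<open>s > b / u\<close> half of the exponent already yields the factor
  \<open>exp (- b / 2)\<close>; the other half stays in \<open>dlexp (u / 2)\<close>.\<close>

lemma integral_high_le:
  assumes "0 < u"
  shows "(\<integral>s. indicator {b / u<..} s * (s * exp (- u * s)) \<partial>M) \<le> exp (- b / 2) * dlexp (u / 2)"
proof -
  have "(\<integral>s. indicator {b / u<..} s * (s * exp (- u * s)) \<partial>M)
        \<le> (\<integral>s. exp (- b / 2) * (s * exp (- (u / 2) * s)) \<partial>M)"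
  proof (rule integral_mono_AE)
    show "AE s in M. indicator {b / u<..} s * (s * exp (- u * s)) \<le> exp (- b / 2) * (s * exp (- (u / 2) * s))"
      using AE_nonneg
    proof eventually_elim
      case (elim s)
      show ?case
      proof (cases "b / u < s")
        case True
        then have "b < u * s" using assms by (simp add: field_simps)
        then have "- u * s \<le> - b / 2 + (- (u / 2) * s)" by simp
        then have "exp (- u * s) \<le> exp (- b / 2) * exp (- (u / 2) * s)"
          by (simp only: exp_le_cancel_iff flip: exp_add)
        then show ?thesis
          using True elim by (simp add: mult_left_mono mult.left_commute)
      qed (use elim in auto)
    qed
    show "integrable M (\<lambda>s. indicator {b / u<..} s * (s * exp (- u * s)))"
      using assms by (intro integrable_indicator_mult_exp) auto
    show "integrable M (\<lambda>s. exp (- b / 2) * (s * exp (- (u / 2) * s)))"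
      using integrable_mult_exp[of "u / 2"] assms by simp
  qed
  then show ?thesis by (simp add: dlexp_def)
qed

text \<open>Serves as a lower bound for the middle integral: once the first two terms are small
  fractions of \<open>dlexp u\<close>, they can be absorbed on the left.\<close>

lemma dlexp_le_split:
  assumes "0 < u" "0 < a" "a \<le> 1"
  shows "dlexp u \<le> exp 1 * dlexp (u / a) + exp (- b / 2) * dlexp (u / 2)
                     + (\<integral>s. indicator {a / u..b / u} s * (s * exp (- u * s)) \<partial>M)"
proof -
  let ?I = "\<lambda>A. \<integral>s. indicator A s * (s * exp (- u * s)) \<partial>M"
  have "dlexp u \<le> (\<integral>s. (indicator {..<a / u} s * (s * exp (- u * s)) + indicator {b / u<..} s * (s * exp (- u * s)))
               + indicator {a / u..b / u} s * (s * exp (- u * s)) \<partial>M)"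
    unfolding dlexp_def
  proof (rule integral_mono_AE)
    show "AE s in M. s * exp (- u * s) \<le> (indicator {..<a / u} s * (s * exp (- u * s))
        + indicator {b / u<..} s * (s * exp (- u * s))) + indicator {a / u..b / u} s * (s * exp (- u * s))"
      using AE_nonneg by eventually_elim (auto split: split_indicator)
  qed (use assms in \<open>intro integrable_mult_exp integrable_indicator_mult_exp Bochner_Integration.integrable_add; simp\<close>)+
  also have "\<dots> = ?I {..<a / u} + ?I {b / u<..} + ?I {a / u..b / u}"
    using integrable_indicator_mult_exp[OF assms(1)] by simp
  finally show ?thesis
    using integral_low_le[OF assms] integral_high_le[OF assms(1), of b] by linarith
qed

end

section \<open>Small-time limit of the laws of a subordinator\<close>

context half_line_levy
begin

text \<open>The weight \<open>1 - exp (- s)\<close> turns \<open>M\<close> into a finite measure of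
  mass \<open>lexp 1\<close>, against which bounded functions of \<open>exp (- s)\<close> are
  integrable.\<close>

lemma integrable_exp_weight:
  assumes [measurable]: "F \<in> borel_measurable borel"
    and bound: "\<And>y. 0 \<le> y \<Longrightarrow> y \<le> 1 \<Longrightarrow> \<bar>F y\<bar> \<le> B"
  shows "integrable M (\<lambda>s. F (exp (- s)) * (1 - exp (- s)))"
proof (rule Bochner_Integration.integrable_bound)
  show "integrable M (\<lambda>s. B * (1 - exp (- 1 * s)))"
    by (intro integrable_mult_right integrable_one_minus_exp) simp
  show "AE s in M. norm (F (exp (- s)) * (1 - exp (- s))) \<le> norm (B * (1 - exp (- 1 * s)))"
    using AE_nonneg
  proof eventually_elim
    case (elim s)
    then show ?case using bound[of "exp (- s)"] by (auto simp: abs_mult intro!: mult_right_mono)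
  qed
qed measurable

lemma abs_integral_exp_weight_le:
  assumes [measurable]: "F \<in> borel_measurable borel"
    and bound: "\<And>y. 0 \<le> y \<Longrightarrow> y \<le> 1 \<Longrightarrow> \<bar>F y\<bar> \<le> B"
  shows "\<bar>\<integral>s. F (exp (- s)) * (1 - exp (- s)) \<partial>M\<bar> \<le> B * lexp 1"
proof -
  have "\<bar>\<integral>s. F (exp (- s)) * (1 - exp (- s)) \<partial>M\<bar> \<le> (\<integral>s. \<bar>F (exp (- s)) * (1 - exp (- s))\<bar> \<partial>M)"
    by simp
  also have "\<dots> \<le> (\<integral>s. B * (1 - exp (- 1 * s)) \<partial>M)"
  proof (rule integral_mono_AE)
    show "integrable M (\<lambda>s. \<bar>F (exp (- s)) * (1 - exp (- s))\<bar>)"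
      using integrable_exp_weight[OF assms] by simp
    show "integrable M (\<lambda>s. B * (1 - exp (- 1 * s)))"
      by (intro integrable_mult_right integrable_one_minus_exp) simp
    show "AE s in M. \<bar>F (exp (- s)) * (1 - exp (- s))\<bar> \<le> B * (1 - exp (- 1 * s))"
      using AE_nonneg
    proof eventually_elim
      case (elim s)
      then show ?case using bound[of "exp (- s)"] by (auto simp: abs_mult intro!: mult_right_mono)
    qed
  qed
  also have "\<dots> = B * lexp 1" by (simp add: lexp_def)
  finally show ?thesis .
qed

text \<open>The moment of order \<open>i\<close> in \<open>exp (- s)\<close> telescopes into a
  difference of Laplace exponents. The summands are written with \<open>1 - exp\<close> because
  \<open>exp (- i * s)\<close> alone need not be integrable when \<open>M\<close> is
  infinite.\<close>

lemma integral_exp_weight_sum: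
  "(\<integral>s. (\<Sum>i\<le>n. a i * exp (- s) ^ i) * (1 - exp (- s)) \<partial>M)
     = (\<Sum>i\<le>n. a i * (lexp (real i + 1) - lexp (real i)))"
proof -
  have "(\<Sum>i\<le>n. a i * exp (- s) ^ i) * (1 - exp (- s))
      = (\<Sum>i\<le>n. a i * ((1 - exp (- (real i + 1) * s)) - (1 - exp (- real i * s))))" for s :: real
    unfolding sum_distrib_right
  proof (rule sum.cong)
    fix i
    have "exp (- s) ^ i = exp (- real i * s)" "exp (- s) ^ i * exp (- s) = exp (- (real i + 1) * s)"
      by (simp_all flip: exp_of_nat_mult exp_add add: algebra_simps)
    then show "a i * exp (- s) ^ i * (1 - exp (- s))
        = a i * ((1 - exp (- (real i + 1) * s)) - (1 - exp (- real i * s)))"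
      by (simp add: algebra_simps)
  qed simp
  then show ?thesis
    using integrable_one_minus_exp[of "real i" for i] integrable_one_minus_exp[of "real i + 1" for i]
    by (simp only: lexp_def Bochner_Integration.integral_sum Bochner_Integration.integral_diff
        integral_mult_right_zero Bochner_Integration.integrable_diff integrable_mult_right
        of_nat_0_le_iff add_nonneg_nonneg zero_le_one)
qed

end

text \<open>The subordinator enters only through its one-dimensional laws, tied to \<open>M\<close>
  by their Laplace transforms.\<close>

locale subordinator_laws = half_line_levy M for M :: "real measure" +
  fixes eta :: "real \<Rightarrow> real measure"
  assumes eta_prob: "\<And>t. t > 0 \<Longrightarrow> prob_space (eta t)"
    and eta_sets: "\<And>t. t > 0 \<Longrightarrow> sets (eta t) = sets borel"
    and eta_supp: "\<And>t. t > 0 \<Longrightarrow> emeasure (eta t) {..<0} = 0"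
    and eta_laplace: "\<And>t u. t > 0 \<Longrightarrow> u \<ge> 0 \<Longrightarrow>
        (\<integral>s. exp (- u * s) \<partial>eta t) = exp (- t * lexp u)"
begin

section \<open>Laplace exponents of the laws \<open>eta t\<close>\<close>

lemma half_line_levy_eta:
  assumes "t > 0"
  shows "half_line_levy (eta t)"
proof
  interpret E: prob_space "eta t" by (rule eta_prob[OF assms])
  note [measurable_cong] = eta_sets[OF assms]
  show "sets (eta t) = sets borel" by (rule eta_sets[OF assms])
  show AE: "AE s in eta t. 0 \<le> s"
    using eta_supp[OF assms] eta_sets[OF assms]
    by (intro AE_I[where N = "{..<0}"]) auto
  show "integrable (eta t) (\<lambda>s. min 1 s)"
    using AE by (intro E.integrable_const_bound[where B = 1]) (auto elim!: eventually_mono)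
qed

lemma lexp_eta:
  assumes "t > 0" "u \<ge> 0"
  shows "half_line_levy.lexp (eta t) u = 1 - exp (- t * lexp u)"
proof -
  interpret E: prob_space "eta t" by (rule eta_prob[OF assms(1)])
  interpret H: half_line_levy "eta t" by (rule half_line_levy_eta[OF assms(1)])
  have "integrable (eta t) (\<lambda>s. 1 - (1 - exp (- u * s)))"
    by (intro Bochner_Integration.integrable_diff H.integrable_one_minus_exp assms) simp
  then have "integrable (eta t) (\<lambda>s. exp (- u * s))" by simp
  then show ?thesis
    unfolding H.lexp_def using eta_laplace[OF assms] by (simp add: E.prob_space)
qed

text \<open>Both sides are the derivative at \<open>u\<close> of
  \<open>1 - exp (- t * lexp u)\<close>: one by \<open>DERIV_lexp\<close> for \<open>eta t\<close>,
  the other by the chain rule.\<close>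

lemma dlexp_eta:
  assumes "t > 0" "u > 0"
  shows "half_line_levy.dlexp (eta t) u = t * dlexp u * exp (- t * lexp u)"
proof -
  interpret H: half_line_levy "eta t" by (rule half_line_levy_eta[OF assms(1)])
  have "((\<lambda>u. 1 - exp (- t * lexp u)) has_real_derivative t * dlexp u * exp (- t * lexp u)) (at u)"
    using DERIV_lexp[OF assms(2)] by (auto intro!: derivative_eq_intros)
  then have "(H.lexp has_real_derivative t * dlexp u * exp (- t * lexp u)) (at u)"
    by (rule has_field_derivative_transform_within_open[where S = "{0<..}"])
       (use assms lexp_eta in auto)
  then show ?thesis using H.DERIV_lexp[OF assms(2)] by (rule DERIV_unique[symmetric])
qed

text \<open>The measures \<open>(1 - exp (- s)) eta t (ds) / t\<close> are bounded in mass, and their moments in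
  \<open>y = exp (- s)\<close> converge by the Laplace transform; Weierstrass approximation on \<open>[0,1]\<close> does the rest.\<close>

lemma tendsto_small_time:
  assumes F: "continuous_on {0..1} F" and [measurable]: "F \<in> borel_measurable borel"
  shows "((\<lambda>t. (\<integral>s. F (exp (- s)) * (1 - exp (- s)) \<partial>eta t) / t)
           \<longlongrightarrow> (\<integral>s. F (exp (- s)) * (1 - exp (- s)) \<partial>M)) (at_right 0)"
proof (rule tendstoI)
  fix e :: real assume e: "e > 0"
  define L where "L = lexp 1"
  have L: "0 \<le> L" unfolding L_def by (rule lexp_nonneg) simp
  \<comment> \<open>The denominator contains \<open>L + 1\<close> rather than \<open>L\<close>
    because \<open>L\<close> may be 0.\<close>
  define \<epsilon> where "\<epsilon> = e / (3 * (L + 1))"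
  have \<epsilon>: "\<epsilon> > 0" "\<epsilon> * L \<le> e / 3"
    using e L by (auto simp: \<epsilon>_def field_simps)
  obtain g where g: "real_polynomial_function g" "\<And>x. x \<in> {0..1} \<Longrightarrow> \<bar>F x - g x\<bar> < \<epsilon>"
    using Stone_Weierstrass_real_polynomial_function[OF compact_Icc F \<epsilon>(1)] by blast
  from g(1) obtain a n where ga: "g = (\<lambda>x. \<Sum>i\<le>n. a i * x ^ i)"
    using real_polynomial_function_iff_sum by blast
  have [measurable]: "g \<in> borel_measurable borel" unfolding ga by measurable
  obtain B where B: "\<And>y. y \<in> {0..1} \<Longrightarrow> \<bar>F y\<bar> \<le> B"
    using compact_imp_bounded[OF compact_continuous_image[OF F compact_Icc]]
    unfolding bounded_iff by (metis imageI real_norm_def)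
  \<comment> \<open>Stated for any half-line measure \<open>K\<close>, since the polynomial replaces
    \<open>F\<close> both under \<open>eta t\<close> and under \<open>M\<close>. The error is the
    uniform distance times the weighted mass.\<close>
  have close: "\<bar>(\<integral>s. F (exp (- s)) * (1 - exp (- s)) \<partial>K) - (\<integral>s. g (exp (- s)) * (1 - exp (- s)) \<partial>K)\<bar>
      \<le> \<epsilon> * half_line_levy.lexp K 1" if "half_line_levy K" for K
  proof -
    interpret K: half_line_levy K by fact
    have Bg: "\<bar>g y\<bar> \<le> B + \<epsilon>" if "0 \<le> y" "y \<le> 1" for y
      using g(2)[of y] B[of y] that by auto
    have iF: "integrable K (\<lambda>s. F (exp (- s)) * (1 - exp (- s)))"
      using B by (intro K.integrable_exp_weight[where B = B]) auto
    have ig: "integrable K (\<lambda>s. g (exp (- s)) * (1 - exp (- s)))"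
      using Bg by (intro K.integrable_exp_weight[where B = "B + \<epsilon>"]) auto
    have "(\<integral>s. F (exp (- s)) * (1 - exp (- s)) \<partial>K) - (\<integral>s. g (exp (- s)) * (1 - exp (- s)) \<partial>K)
       = (\<integral>s. (F (exp (- s)) - g (exp (- s))) * (1 - exp (- s)) \<partial>K)"
      by (subst Bochner_Integration.integral_diff[OF iF ig, symmetric]) (simp add: algebra_simps)
    also have "\<bar>\<dots>\<bar> \<le> \<epsilon> * K.lexp 1"
      using g(2) by (intro K.abs_integral_exp_weight_le[where F = "\<lambda>y. F y - g y"]) (auto intro: less_imp_le)
    finally show ?thesis .
  qed
  have "((\<lambda>t. (\<Sum>i\<le>n. a i * ((1 - exp (- t * lexp (real i + 1))) / t - (1 - exp (- t * lexp (real i))) / t)))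
      \<longlongrightarrow> (\<Sum>i\<le>n. a i * (lexp (real i + 1) - lexp (real i)))) (at_right 0)"
  proof (intro tendsto_intros)
    have "((\<lambda>t. (1 - exp (- t * c)) / t) \<longlongrightarrow> c) (at_right 0)" for c :: real
      by real_asymp
    then show "((\<lambda>t. (1 - exp (- t * lexp (real i + 1))) / t) \<longlongrightarrow> lexp (real i + 1)) (at_right 0)"
      "((\<lambda>t. (1 - exp (- t * lexp (real i))) / t) \<longlongrightarrow> lexp (real i)) (at_right 0)" for i
      by blast+
  qed
  then have "\<forall>\<^sub>F t in at_right 0. \<bar>(\<Sum>i\<le>n. a i * ((1 - exp (- t * lexp (real i + 1))) / t - (1 - exp (- t * lexp (real i))) / t))
      - (\<Sum>i\<le>n. a i * (lexp (real i + 1) - lexp (real i)))\<bar> < e / 3"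
    using e by (auto dest!: tendstoD[where e = "e / 3"] simp: dist_real_def)
  moreover have "\<forall>\<^sub>F t in at_right 0. (0::real) < t"
    by (simp add: eventually_at_right_less)
  ultimately show "\<forall>\<^sub>F t in at_right 0. dist ((\<integral>s. F (exp (- s)) * (1 - exp (- s)) \<partial>eta t) / t)
      (\<integral>s. F (exp (- s)) * (1 - exp (- s)) \<partial>M) < e"
  proof eventually_elim
    case (elim t)
    interpret H: half_line_levy "eta t" by (rule half_line_levy_eta) fact
    let ?F = "\<lambda>K. \<integral>s. F (exp (- s)) * (1 - exp (- s)) \<partial>K"
    let ?g = "\<lambda>K. \<integral>s. g (exp (- s)) * (1 - exp (- s)) \<partial>K"
    have "?g M = (\<Sum>i\<le>n. a i * (lexp (real i + 1) - lexp (real i)))"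
      unfolding ga by (rule integral_exp_weight_sum)
    moreover have "?g (eta t) / t = (\<Sum>i\<le>n. a i * ((1 - exp (- t * lexp (real i + 1))) / t - (1 - exp (- t * lexp (real i))) / t))"
      unfolding ga H.integral_exp_weight_sum sum_divide_distrib using \<open>0 < t\<close>
      by (intro sum.cong) (auto simp: lexp_eta field_simps)
    ultimately have 1: "\<bar>?g (eta t) / t - ?g M\<bar> < e / 3"
      using elim by simp
    \<comment> \<open>The weighted mass of \<open>eta t\<close> is at most \<open>t * L\<close>, so
      the approximation error remains at most \<open>e / 3\<close> after division by
      \<open>t\<close>.\<close>
    have "1 - exp (- t * L) \<le> t * L"
      using exp_ge_add_one_self[of "- t * L"] by simp
    then have "H.lexp 1 \<le> t * L"
      using elim lexp_eta[of t 1] by (simp add: L_def)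
    then have "\<epsilon> * H.lexp 1 \<le> t * (\<epsilon> * L)"
      using \<epsilon>(1) by (simp add: mult_left_mono mult.left_commute)
    also have "\<dots> \<le> t * (e / 3)"
      using \<epsilon>(2) elim by (intro mult_left_mono) auto
    finally have "\<bar>?F (eta t) - ?g (eta t)\<bar> \<le> t * (e / 3)"
      using close[OF half_line_levy_eta[OF \<open>0 < t\<close>]] by linarith
    then have 2: "\<bar>?F (eta t) / t - ?g (eta t) / t\<bar> \<le> e / 3"
      using elim by (simp add: field_simps flip: diff_divide_distrib)
    have 3: "\<bar>?F M - ?g M\<bar> \<le> e / 3"
      using close[OF half_line_levy_axioms] \<epsilon>(2) unfolding L_def by linarith
    from 1 2 3 show ?case unfolding dist_real_def by linarith
  qed
qed

end

section \<open>The heat kernel\<close>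

lemma heat_kernel_nonneg: "0 \<le> heat_kernel d s r"
  by (simp add: heat_kernel_def)

lemma heat_kernel_at_0 [simp]: "heat_kernel d 0 r = 0"
  by (simp add: heat_kernel_def)

lemma measurable_heat_kernel [measurable]: "(\<lambda>s. heat_kernel d s r) \<in> borel_measurable borel"
  unfolding heat_kernel_def by measurable

text \<open>The heat kernel as a multiple of the weight \<open>1 - exp (- s)\<close>, in the variable \<open>y = exp (- s)\<close>.
  The junk values at \<open>y = 0\<close> and \<open>y = 1\<close> are \<open>0\<close>, which are also the limits there.\<close>
definition heat_weight :: "nat \<Rightarrow> real \<Rightarrow> real \<Rightarrow> real" where
  "heat_weight d r y = heat_kernel d (- ln y) r / (1 - y)"

lemma heat_weight_exp: "heat_weight d r (exp (- s)) * (1 - exp (- s)) = heat_kernel d s r"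
  by (cases "s = 0") (auto simp: heat_weight_def)

lemma measurable_heat_weight [measurable]: "heat_weight d r \<in> borel_measurable borel"
  unfolding heat_weight_def heat_kernel_def by measurable

text \<open>The end point \<open>y = 0\<close> is \<open>s\<close> tending to infinity, where the
  kernel decays because \<open>d > 0\<close>. The end point \<open>y = 1\<close> is \<open>s\<close>
  tending to 0, where for \<open>r > 0\<close> the Gaussian factor beats both the power of
  \<open>s\<close> and \<open>1 / (1 - y)\<close>.\<close>

lemma continuous_on_heat_weight:
  assumes "d > 0" "r > 0"
  shows "continuous_on {0..1} (heat_weight d r)"
proof -
  have c: "r\<^sup>2 > 0" and k: "real d / 2 > 0" using assms by auto
  have e: "heat_weight d r = (\<lambda>y. (4 * pi * (- ln y)) powr (- (real d / 2)) * exp (- r\<^sup>2 / (4 * (- ln y))) / (1 - y))"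
    by (auto simp: heat_weight_def heat_kernel_def)
  have 0: "(heat_weight d r \<longlongrightarrow> 0) (at_right 0)"
    unfolding e using c k by real_asymp
  have 1: "(heat_weight d r \<longlongrightarrow> 0) (at_left 1)"
    unfolding e using c k by real_asymp
  have z: "heat_weight d r 0 = 0" "heat_weight d r 1 = 0" by (auto simp: heat_weight_def)
  have inner: "isCont (heat_weight d r) y" if "0 < y" "y < 1" for y
    using that unfolding e by (intro continuous_intros) auto
  show ?thesis
    unfolding continuous_on_eq_continuous_within
  proof
    fix y :: real assume "y \<in> {0..1}"
    then consider "y = 0" | "y = 1" | "0 < y" "y < 1" by fastforce
    then show "continuous (at y within {0..1}) (heat_weight d r)"
    proof cases
      case 1
      then show ?thesis using 0 z
        by (simp add: continuous_within at_within_Icc_at_right)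
    next
      case 2
      then show ?thesis using \<open>(heat_weight d r \<longlongrightarrow> 0) (at_left 1)\<close> z
        by (simp add: continuous_within at_within_Icc_at_left)
    next
      case 3
      then show ?thesis using inner continuous_at_imp_continuous_at_within by blast
    qed
  qed
qed

lemma (in half_line_levy) integrable_heat_kernel:
  assumes "d > 0" "r > 0"
  shows "integrable M (\<lambda>s. heat_kernel d s r)"
proof -
  note F = continuous_on_heat_weight[OF assms]
  obtain B where "\<And>y. y \<in> {0..1} \<Longrightarrow> \<bar>heat_weight d r y\<bar> \<le> B"
    using compact_imp_bounded[OF compact_continuous_image[OF F compact_Icc]]
    unfolding bounded_iff by (metis imageI real_norm_def)
  then show ?thesis
    using integrable_exp_weight[of "heat_weight d r" B] by (simp add: heat_weight_exp)
qed

text \<open>For the Levy measure this says that \<open>p(t,x) / t\<close> tends to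
  \<open>\<nu>(x)\<close>, with \<open>r\<close> the norm of \<open>x\<close>.\<close>

lemma (in subordinator_laws) tendsto_heat_kernel:
  assumes "d > 0" "r > 0"
  shows "((\<lambda>t. (\<integral>s. heat_kernel d s r \<partial>eta t) / t) \<longlongrightarrow> (\<integral>s. heat_kernel d s r \<partial>M)) (at_right 0)"
  using tendsto_small_time[OF continuous_on_heat_weight[OF assms]] by (simp add: heat_weight_exp)

section \<open>Scaling implies the heat kernel bound\<close>

lemma powr_minus_nat_add_2:
  assumes "0 < r"
  shows "r powr (- real d - 2) = (r\<^sup>2) powr (- real d / 2) / r\<^sup>2"
proof -
  have "(r\<^sup>2) powr (- real d / 2) = r powr (- real d)"
    using assms by (simp add: powr_powr flip: powr_numeral)
  then show ?thesis using assms by (simp add: powr_diff powr_numeral)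
qed

text \<open>Each factor is taken at its worst end point: the power and the factor \<open>s\<close>
  at \<open>b * r\<^sup>2\<close>, the Gaussian at \<open>a * r\<^sup>2\<close>. The factor
  \<open>s * exp (- (1 / r\<^sup>2) * s)\<close> is kept so that integration yields the windowed
  part of \<open>dlexp (1 / r\<^sup>2)\<close>.\<close>

lemma heat_kernel_ge_on_Icc:
  assumes "0 < a" "0 < r" "s \<in> {a * r\<^sup>2..b * r\<^sup>2}"
  shows "(4 * pi * b) powr (- real d / 2) * exp (- 1 / (4 * a)) / b * r powr (- real d - 2)
           * (s * exp (- (1 / r\<^sup>2) * s)) \<le> heat_kernel d s r"
proof -
  define k where "k = real d / 2"
  have r2: "0 < r\<^sup>2" using assms by simp
  have s: "0 < s" "a * r\<^sup>2 \<le> s" "s \<le> b * r\<^sup>2"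
    using assms r2 by (auto intro: less_le_trans[of 0 "a * r\<^sup>2"])
  then have b: "0 < b" using r2 by (smt (verit) zero_less_mult_pos2)
  have "s * exp (- (1 / r\<^sup>2) * s) \<le> b * r\<^sup>2 * 1"
    using s r2 b by (intro mult_mono) auto
  then have "(4 * pi * b) powr (- k) * exp (- 1 / (4 * a)) / b * ((r\<^sup>2) powr (- k) / r\<^sup>2)
           * (s * exp (- (1 / r\<^sup>2) * s))
      \<le> (4 * pi * b) powr (- k) * exp (- 1 / (4 * a)) / b * ((r\<^sup>2) powr (- k) / r\<^sup>2) * (b * r\<^sup>2)"
    using b by (intro mult_left_mono) auto
  also have "\<dots> = (4 * pi * (b * r\<^sup>2)) powr (- k) * exp (- 1 / (4 * a))"
    using b r2 by (simp add: powr_mult mult_ac)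
  also have "\<dots> \<le> (4 * pi * s) powr (- k) * exp (- r\<^sup>2 / (4 * s))"
  proof (intro mult_mono)
    show "(4 * pi * (b * r\<^sup>2)) powr (- k) \<le> (4 * pi * s) powr (- k)"
      using s by (intro powr_mono2') (auto simp: k_def)
    show "exp (- 1 / (4 * a)) \<le> exp (- r\<^sup>2 / (4 * s))"
      using s assms by (simp add: field_simps)
  qed auto
  finally show ?thesis
    by (simp add: heat_kernel_def powr_minus_nat_add_2[OF \<open>0 < r\<close>] k_def)
qed

context subordinator_laws
begin

text \<open>Differentiating the Laplace transform of \<open>eta t\<close> gives
  \<open>\<integral> s exp (- u s) eta t (ds) = t \<phi>'(u) exp (- t \<phi>(u))\<close>. Scaling and doubling of \<open>\<phi>'\<close> make the
  contributions of \<open>s < a / u\<close> and \<open>s > b / u\<close> to this integral negligible.\<close>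

lemma eta_mass_Icc_ge:
  assumes t: "0 < t" and u: "0 < u" and tu: "t * lexp u \<le> 1"
    and a: "0 < a" "a \<le> 1" and low: "dlexp (u / a) \<le> dlexp u * exp (- 2) / 4"
    and high: "dlexp (u / 2) \<le> 4 * dlexp u"
  shows "exp (- 1) / 2 * t * dlexp u
     \<le> (\<integral>s. indicator {a / u..2 * (1 + ln 16) / u} s * (s * exp (- u * s)) \<partial>eta t)"
    (is "_ \<le> ?I")
proof -
  interpret H: half_line_levy "eta t" by (rule half_line_levy_eta[OF t])
  \<comment> \<open>The factor \<open>exp (- t * lexp v)\<close> is dropped here; at
    \<open>u\<close> itself it is at least \<open>exp (- 1)\<close> because
    \<open>t * lexp u \<le> 1\<close>.\<close>
  have up: "H.dlexp v \<le> t * dlexp v" if "0 < v" for v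
    unfolding dlexp_eta[OF t that] using t that dlexp_nonneg[of v] lexp_nonneg[of v]
    by (intro mult_right_le_one_le) auto
  have "exp (- 1) * t * dlexp u \<le> H.dlexp u"
    unfolding dlexp_eta[OF t u] using tu t dlexp_nonneg[of u]
    by (simp add: mult_ac mult_left_mono)
  \<comment> \<open>With \<open>b = 2 * (1 + ln 16)\<close> the factor \<open>exp (- b / 2)\<close>
    is \<open>exp (- 1) / 16\<close>, so the high part, after doubling, costs
    \<open>exp (- 1) / 4\<close>. The low part costs the same, leaving half of
    \<open>exp (- 1)\<close>.\<close>
  also have "\<dots> \<le> exp 1 * H.dlexp (u / a) + exp (- (2 * (1 + ln 16)) / 2) * H.dlexp (u / 2) + ?I"
    by (rule H.dlexp_le_split[OF u a])
  also have "exp 1 * H.dlexp (u / a) \<le> exp 1 * (t * (dlexp u * exp (- 2) / 4))"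
    using up[of "u / a"] low u a t by (intro mult_left_mono order_trans[OF up]) auto
  also have "\<dots> = exp (- 1) / 4 * t * dlexp u"
    using exp_add[of 1 "- 2 :: real"] by simp
  also have "exp (- (2 * (1 + ln 16)) / 2) * H.dlexp (u / 2) \<le> exp (- (2 * (1 + ln 16)) / 2) * (t * (4 * dlexp u))"
    using high u t by (intro mult_left_mono order_trans[OF up]) auto
  also have "exp (- (2 * (1 + ln 16)) / 2) = exp (- 1) / (16::real)"
    by (simp add: exp_diff diff_divide_distrib)
  finally show ?thesis by (simp add: algebra_simps)
qed

text \<open>The pointwise bound \<open>heat_kernel_ge_on_Icc\<close> is integrated over the window
  of \<open>eta_mass_Icc_ge\<close> with \<open>u = 1 / r\<^sup>2\<close>; elsewhere the kernel is
  nonnegative. The resulting constant does not depend on \<open>t\<close> or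
  \<open>r\<close>.\<close>

lemma heat_kernel_mean_ge:
  assumes d: "0 < d" and r: "0 < r" and t: "0 < t" and tr: "t * lexp (1 / r\<^sup>2) \<le> 1"
    and a: "0 < a" "a \<le> 1" and low: "dlexp (1 / r\<^sup>2 / a) \<le> dlexp (1 / r\<^sup>2) * exp (- 2) / 4"
    and high: "dlexp (1 / r\<^sup>2 / 2) \<le> 4 * dlexp (1 / r\<^sup>2)"
    and b: "b = 2 * (1 + ln 16)"
  shows "(4 * pi * b) powr (- real d / 2) * exp (- 1 / (4 * a)) / b * (exp (- 1) / 2)
           * t * r powr (- real d - 2) * dlexp (1 / r\<^sup>2) \<le> (\<integral>s. heat_kernel d s r \<partial>eta t)"
proof -
  interpret H: half_line_levy "eta t" by (rule half_line_levy_eta[OF t])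
  define u where "u = 1 / r\<^sup>2"
  have u: "0 < u" using r by (simp add: u_def)
  have b0: "0 < b" unfolding b by (simp add: add_pos_pos)
  define \<kappa> where "\<kappa> = (4 * pi * b) powr (- real d / 2) * exp (- 1 / (4 * a)) / b * r powr (- real d - 2)"
  have \<kappa>: "0 \<le> \<kappa>" using b0 by (simp add: \<kappa>_def)
  have "\<kappa> * (exp (- 1) / 2 * t * dlexp u) \<le> \<kappa> * (\<integral>s. indicator {a / u..b / u} s * (s * exp (- u * s)) \<partial>eta t)"
    using eta_mass_Icc_ge[OF t u] tr a low high b unfolding u_def
    by (intro mult_left_mono \<kappa>) auto
  also have "\<dots> = (\<integral>s. \<kappa> * (indicator {a / u..b / u} s * (s * exp (- u * s))) \<partial>eta t)"
    by simp
  also have "\<dots> \<le> (\<integral>s. heat_kernel d s r \<partial>eta t)"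
  proof (rule integral_mono)
    show "integrable (eta t) (\<lambda>s. \<kappa> * (indicator {a / u..b / u} s * (s * exp (- u * s))))"
      by (intro integrable_mult_right H.integrable_indicator_mult_exp u) simp
    show "integrable (eta t) (\<lambda>s. heat_kernel d s r)"
      by (rule H.integrable_heat_kernel[OF d r])
    show "\<kappa> * (indicator {a / u..b / u} s * (s * exp (- u * s))) \<le> heat_kernel d s r" for s
      using heat_kernel_ge_on_Icc[OF a(1) r, of s b d] heat_kernel_nonneg[of d s r]
      by (auto simp: \<kappa>_def u_def split: split_indicator)
  qed
  finally show ?thesis by (simp add: \<kappa>_def u_def mult_ac)
qed

end

text \<open>Scaling by \<open>1 / a\<close> gains the factor \<open>c * a powr \<alpha>\<close>,
  which is at most \<open>e\<close> for small \<open>a\<close>. This supplies the hypothesis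
  \<open>low\<close> of \<open>heat_kernel_mean_ge\<close>.\<close>

lemma WUSC_shrink:
  assumes "WUSC f (- \<alpha>) \<theta> c" "0 < \<alpha>" "1 \<le> c" "0 < e"
  obtains a where "0 < a" "a \<le> 1" "\<And>u. \<theta> < u \<Longrightarrow> 0 \<le> f u \<Longrightarrow> f (u / a) \<le> e * f u"
proof
  define a where "a = min 1 ((e / c) powr (1 / \<alpha>))"
  show a: "0 < a" "a \<le> 1" using assms by (auto simp: a_def)
  have "a powr \<alpha> \<le> ((e / c) powr (1 / \<alpha>)) powr \<alpha>"
    using assms a by (intro powr_mono2) (auto simp: a_def)
  also have "\<dots> = e / c" using assms by (simp add: powr_powr)
  finally have ca: "c * a powr \<alpha> \<le> e" using assms by (simp add: field_simps)
  fix u assume u: "\<theta> < u" "0 \<le> f u"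
  have "f ((1 / a) * u) \<le> c * (1 / a) powr (- \<alpha>) * f u"
    using assms(1) u(1) a unfolding WUSC_def by (auto simp del: times_divide_eq_left)
  also have "(1 / a) powr (- \<alpha>) = a powr \<alpha>"
    using a by (simp add: powr_divide powr_minus_divide)
  also have "c * a powr \<alpha> * f u \<le> e * f u"
    using ca u by (intro mult_right_mono) auto
  finally show "f (u / a) \<le> e * f u" by simp
qed

section \<open>The jump density bound implies scaling\<close>

text \<open>Iterating the halving gives decay along powers of 2 with
  \<open>q = 2 powr (- \<alpha>)\<close>, and monotonicity fills the gaps between them.\<close>

lemma WUSC_of_halving:
  fixes f :: "real \<Rightarrow> real"
  assumes anti: "\<And>u v. 0 < u \<Longrightarrow> u \<le> v \<Longrightarrow> f v \<le> f u"
    and halve: "\<And>u. \<theta> < u \<Longrightarrow> f (2 * u) \<le> q * f u"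
    and nonneg: "\<And>u. 0 < u \<Longrightarrow> 0 \<le> f u"
    and q: "0 < q" "q < 1" and \<theta>: "0 \<le> \<theta>"
  shows "\<exists>\<alpha>>0. \<exists>c\<ge>1. WUSC f (- \<alpha>) \<theta> c"
proof (intro exI conjI)
  define \<alpha> where "\<alpha> = - log 2 q"
  show \<alpha>: "\<alpha> > 0" using q by (simp add: \<alpha>_def)
  show "1 / q \<ge> 1" using q by simp
  have q_eq: "q = 2 powr (- \<alpha>)" using q by (simp add: \<alpha>_def)
  have iter: "f (2 ^ n * u) \<le> q ^ n * f u" if "\<theta> < u" for n u
  proof (induction n)
    case (Suc n)
    have "1 * u \<le> 2 ^ n * u" using that \<theta> by (intro mult_right_mono) auto
    then have "f (2 * (2 ^ n * u)) \<le> q * f (2 ^ n * u)"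
      using that by (intro halve) simp
    also have "\<dots> \<le> q * (q ^ n * f u)" using Suc q by (intro mult_left_mono) auto
    finally show ?case by (simp add: mult_ac)
  qed simp
  show "WUSC f (- \<alpha>) \<theta> (1 / q)"
    unfolding WUSC_def
  proof (intro allI impI)
    fix l u :: real assume l: "1 \<le> l" and u: "\<theta> < u"
    \<comment> \<open>Rounding \<open>l\<close> down to \<open>2 ^ n\<close> loses at most one
      halving; this is the constant \<open>1 / q\<close>.\<close>
    define n where "n = nat \<lfloor>log 2 l\<rfloor>"
    have "0 \<le> log 2 l" using l by simp
    then have n: "real n \<le> log 2 l" "log 2 l < real n + 1"
      by (simp_all add: n_def)
    have "2 powr real n \<le> l" using n(1) l by (simp add: le_log_iff)
    then have "f (l * u) \<le> f (2 ^ n * u)"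
      using u \<theta> by (intro anti) (auto simp: powr_realpow)
    also have "\<dots> \<le> q ^ n * f u" by (rule iter[OF u])
    also have "\<dots> \<le> 1 / q * l powr (- \<alpha>) * f u"
    proof (rule mult_right_mono)
      have "l \<le> 2 powr (real n + 1)" using n(2) l by (simp flip: log_le_iff)
      then have "(2 powr (real n + 1)) powr (- \<alpha>) \<le> l powr (- \<alpha>)"
        using l \<alpha> by (intro powr_mono2') auto
      also have "(2 powr (real n + 1)) powr (- \<alpha>) = (2 powr (- \<alpha>)) powr (real n + 1)"
        by (simp add: powr_powr mult.commute)
      also have "\<dots> = q ^ n * q"
        using q by (simp add: q_eq[symmetric] powr_add powr_realpow)
      finally show "q ^ n \<le> 1 / q * l powr (- \<alpha>)" using q by (simp add: field_simps)
    qed (use u \<theta> nonneg in auto)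
    finally show "f (l * u) \<le> 1 / q * l powr (- \<alpha>) * f u" .
  qed
qed

section \<open>Upper bounds for power tails and for the heat kernel\<close>

lemma nn_integral_powr_atLeast:
  fixes A k :: real
  assumes "0 < A" "1 < k"
  shows "(\<integral>\<^sup>+s. ennreal (s powr (- k)) * indicator {A..} s \<partial>lborel) = ennreal (A powr (1 - k) / (k - 1))"
proof -
  have "(\<integral>\<^sup>+s. ennreal (s powr (- k)) * indicator {A..} s \<partial>lborel)
      = ennreal (0 - (- (A powr (1 - k) / (k - 1))))"
  proof (rule nn_integral_FTC_atLeast)
    fix s assume "A \<le> s"
    then show "((\<lambda>s. - (s powr (1 - k) / (k - 1))) has_real_derivative s powr (- k)) (at s)"
      using assms by (auto intro!: derivative_eq_intros simp: divide_simps) (simp add: algebra_simps)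
  next
    show "((\<lambda>s. - (s powr (1 - k) / (k - 1))) \<longlongrightarrow> 0) at_top"
      using assms by real_asymp
  qed auto
  then show ?thesis by simp
qed

text \<open>With \<open>s = v * r\<^sup>2\<close> the kernel is \<open>r powr (- d)\<close> times a
  function of \<open>v\<close> alone that vanishes faster than \<open>v\<close> at 0. Hence
  \<open>\<delta>\<close> can be chosen independently of \<open>r\<close>.\<close>

lemma heat_kernel_low:
  assumes "0 < \<epsilon>"
  obtains \<delta> where "0 < \<delta>" "\<delta> \<le> 1"
    "\<And>s r. 0 < r \<Longrightarrow> 0 < s \<Longrightarrow> s < \<delta> * r\<^sup>2 \<Longrightarrow> heat_kernel d s r \<le> \<epsilon> * r powr (- real d - 2) * s"
proof -
  define k where "k = real d / 2"
  have "((\<lambda>v::real. (4 * pi * v) powr (- k) * exp (- 1 / (4 * v)) / v) \<longlongrightarrow> 0) (at_right 0)"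
    by real_asymp
  then have "\<forall>\<^sub>F v in at_right 0. (4 * pi * v) powr (- k) * exp (- 1 / (4 * v)) / v < \<epsilon>"
    using assms by (rule order_tendstoD)
  then obtain b where b: "b > 0" "\<And>v. 0 < v \<Longrightarrow> v < b \<Longrightarrow> (4 * pi * v) powr (- k) * exp (- 1 / (4 * v)) / v < \<epsilon>"
    unfolding eventually_at_right_field by auto
  show ?thesis
  proof
    show "0 < min 1 b" "min 1 b \<le> 1" using b by auto
    fix s r :: real assume r: "0 < r" and s: "0 < s" "s < min 1 b * r\<^sup>2"
    define v where "v = s / r\<^sup>2"
    have r2: "0 < r\<^sup>2" using r by simp
    have v: "0 < v" "v < b" "s = v * r\<^sup>2"
      using s r2 by (auto simp: v_def pos_divide_less_eq intro: less_le_trans mult_right_mono)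
    have "heat_kernel d s r = (r\<^sup>2) powr (- k) * ((4 * pi * v) powr (- k) * exp (- 1 / (4 * v)))"
      using r2 v by (simp add: heat_kernel_def k_def powr_mult mult_ac)
    also have "\<dots> \<le> (r\<^sup>2) powr (- k) * (\<epsilon> * v)"
      using b(2)[OF v(1,2)] v by (intro mult_left_mono) (auto simp: field_simps)
    also have "\<dots> = \<epsilon> * r powr (- real d - 2) * s"
      unfolding powr_minus_nat_add_2[OF r] using r2 v(3) by (simp add: k_def mult_ac)
    finally show "heat_kernel d s r \<le> \<epsilon> * r powr (- real d - 2) * s" .
  qed
qed

lemma heat_kernel_le_powr:
  assumes "0 < s"
  shows "heat_kernel d s r \<le> s powr (- real d / 2)"
proof -
  have "1 * s \<le> 4 * pi * s" using assms pi_gt3 by (intro mult_right_mono) auto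
  then have "(4 * pi * s) powr (- real d / 2) \<le> s powr (- real d / 2)"
    using assms by (intro powr_mono2') auto
  then have "(4 * pi * s) powr (- real d / 2) * exp (- r\<^sup>2 / (4 * s)) \<le> s powr (- real d / 2) * 1"
    using assms by (intro mult_mono) auto
  then show ?thesis by (simp add: heat_kernel_def)
qed

section \<open>Levy measures with a non-increasing density\<close>

locale decreasing_levy_density =
  fixes m :: "real \<Rightarrow> real"
  assumes m_meas [measurable]: "m \<in> borel_measurable borel"
    and m_nonneg: "\<And>s. s > 0 \<Longrightarrow> m s \<ge> 0"
    and m_noninc: "\<And>s s'. 0 < s \<Longrightarrow> s \<le> s' \<Longrightarrow> m s' \<le> m s"
    and m_levy: "(\<integral>\<^sup>+ s\<in>{0<..}. ennreal (min 1 s * m s) \<partial>lborel) < \<infinity>"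
begin

text \<open>The indicator discards the unconstrained values of \<open>m\<close> at nonpositive
  arguments.\<close>

definition jumps :: "real measure" where
  "jumps = density lborel (\<lambda>s. ennreal (indicator {0<..} s * m s))"

lemma indicator_m_nonneg: "0 \<le> indicator {0<..} s * m s"
  using m_nonneg[of s] by (auto split: split_indicator)

lemma integral_jumps:
  assumes "f \<in> borel_measurable borel"
  shows "(\<integral>s. f s \<partial>jumps) = (\<integral>s. indicator {0<..} s * m s * f s \<partial>lborel)"
  unfolding jumps_def
  by (subst integral_density) (use assms indicator_m_nonneg in auto)

lemma integrable_jumps:
  assumes "f \<in> borel_measurable borel"
  shows "integrable jumps f \<longleftrightarrow> integrable lborel (\<lambda>s. indicator {0<..} s * m s * f s)"
  unfolding jumps_def
  by (subst integrable_density) (use assms indicator_m_nonneg in auto)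

sublocale half_line_levy jumps
proof
  show "sets jumps = sets borel" by (simp add: jumps_def)
  show "AE s in jumps. 0 \<le> s"
    unfolding jumps_def by (subst AE_density) (auto split: split_indicator)
  have "integrable lborel (\<lambda>s. indicator {0<..} s * m s * min 1 s)"
  proof (rule integrableI_nonneg)
    show "AE s in lborel. 0 \<le> indicator {0<..} s * m s * min 1 s"
      using m_nonneg by (auto split: split_indicator)
    have "(\<integral>\<^sup>+ s. ennreal (indicator {0<..} s * m s * min 1 s) \<partial>lborel)
        = (\<integral>\<^sup>+ s\<in>{0<..}. ennreal (min 1 s * m s) \<partial>lborel)"
      by (intro nn_integral_cong) (auto split: split_indicator simp: mult.commute)
    then show "(\<integral>\<^sup>+ s. ennreal (indicator {0<..} s * m s * min 1 s) \<partial>lborel) < \<infinity>"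
      using m_levy by simp
  qed measurable
  then show "integrable jumps (\<lambda>s. min 1 s)"
    by (subst integrable_jumps) auto
qed

lemma bernstein_phi_eq_lexp: "bernstein_phi m = lexp"
  unfolding bernstein_phi_def lexp_def set_lebesgue_integral_def
  by (rule ext, subst integral_jumps) (auto simp: mult_ac)

lemma sbm_levy_density_eq:
  "sbm_levy_density d m x = (\<integral>s. heat_kernel d s (norm x) \<partial>jumps)"
  unfolding sbm_levy_density_def set_lebesgue_integral_def
  by (subst integral_jumps) (auto simp: mult_ac)

lemma integrable_lborel_mult_exp:
  assumes "0 < u"
  shows "integrable lborel (\<lambda>s. indicator {0<..} s * m s * (s * exp (- u * s)))"
  using integrable_mult_exp[OF assms] by (subst (asm) integrable_jumps) auto

lemma dlexp_eq_lborel: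
  "dlexp u = (\<integral>s. indicator {0<..} s * m s * (s * exp (- u * s)) \<partial>lborel)"
  unfolding dlexp_def by (rule integral_jumps) measurable

text \<open>Substituting \<open>2 * s\<close> for \<open>s\<close> restores the exponent
  \<open>u * s\<close> and produces the factor 4, one 2 from \<open>ds\<close> and one from
  \<open>s\<close>; then \<open>m (2 * s) \<le> m s\<close>.\<close>

lemma dlexp_half_le:
  assumes "0 < u"
  shows "dlexp (u / 2) \<le> 4 * dlexp u"
proof -
  let ?g = "\<lambda>u s. indicator {0<..} s * m s * (s * exp (- u * s))"
  have "dlexp (u / 2) = 2 * (\<integral>s. ?g (u / 2) (2 * s) \<partial>lborel)"
    unfolding dlexp_eq_lborel using lborel_integral_real_affine[of 2 "?g (u / 2)" 0] by simp
  moreover have "(\<integral>s. ?g (u / 2) (2 * s) \<partial>lborel) \<le> (\<integral>s. 2 * ?g u s \<partial>lborel)"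
  proof (rule integral_mono)
    show "integrable lborel (\<lambda>s. ?g (u / 2) (2 * s))"
      using lborel_integrable_real_affine[OF integrable_lborel_mult_exp[of "u / 2"], of 2 0] assms by simp
    show "integrable lborel (\<lambda>s. 2 * ?g u s)"
      using integrable_lborel_mult_exp[OF assms] by (rule integrable_mult_right)
    show "?g (u / 2) (2 * s) \<le> 2 * ?g u s" for s
      using m_noninc[of s "2 * s"] by (auto split: split_indicator intro!: mult_right_mono)
  qed
  moreover have "(\<integral>s. 2 * ?g u s \<partial>lborel) = 2 * dlexp u"
    unfolding dlexp_eq_lborel by (rule integral_mult_right_zero)
  ultimately show ?thesis by linarith
qed

text \<open>The integral is split at \<open>A = \<delta> * r\<^sup>2\<close>. Below
  \<open>A\<close>, where \<open>s \<le> r\<^sup>2\<close>, inserting the exponential costs a factor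
  \<open>exp 1\<close> and gives \<open>dlexp\<close>. Above \<open>A\<close>,
  \<open>m s \<le> m A\<close>, and the kernel is at most \<open>s powr (- d / 2)\<close>, which is
  integrable at infinity since \<open>d / 2 > 1\<close>.\<close>

lemma levy_density_le:
  assumes d: "3 \<le> d" and r: "0 < r" and \<delta>: "0 < \<delta>" "\<delta> \<le> 1"
    and low: "\<And>s. 0 < s \<Longrightarrow> s < \<delta> * r\<^sup>2 \<Longrightarrow> heat_kernel d s r \<le> \<epsilon> * r powr (- real d - 2) * s"
    and \<epsilon>: "0 \<le> \<epsilon>"
  shows "(\<integral>s. heat_kernel d s r \<partial>jumps)
     \<le> \<epsilon> * exp 1 * r powr (- real d - 2) * dlexp (1 / r\<^sup>2)
       + m (\<delta> * r\<^sup>2) * ((\<delta> * r\<^sup>2) powr (1 - real d / 2) / (real d / 2 - 1))"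
proof -
  define A where "A = \<delta> * r\<^sup>2"
  define k where "k = real d / 2"
  have r2: "0 < r\<^sup>2" using r by simp
  have A: "0 < A" using r2 \<delta> by (simp add: A_def)
  have k: "1 < k" using d by (simp add: k_def)
  have tail: "has_bochner_integral lborel (\<lambda>s. indicator {A..} s * s powr (- k)) (A powr (1 - k) / (k - 1))"
  proof (rule has_bochner_integral_nn_integral)
    have "(\<integral>\<^sup>+s. ennreal (indicator {A..} s * s powr (- k)) \<partial>lborel)
        = (\<integral>\<^sup>+s. ennreal (s powr (- k)) * indicator {A..} s \<partial>lborel)"
      by (intro nn_integral_cong) (auto split: split_indicator)
    then show "(\<integral>\<^sup>+s. ennreal (indicator {A..} s * s powr (- k)) \<partial>lborel) = ennreal (A powr (1 - k) / (k - 1))"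
      using nn_integral_powr_atLeast[OF A k] by simp
  qed (use k in auto)
  define c where "c = \<epsilon> * exp 1 * r powr (- real d - 2)"
  have c: "0 \<le> c" using \<epsilon> by (simp add: c_def)
  define g where "g s = indicator {0<..} s * m s * (s * exp (- (1 / r\<^sup>2) * s))" for s
  have g: "integrable lborel g" "integral\<^sup>L lborel g = dlexp (1 / r\<^sup>2)"
    using integrable_lborel_mult_exp[of "1 / r\<^sup>2"] r2 dlexp_eq_lborel[of "1 / r\<^sup>2"]
    unfolding g_def by simp_all
  have "(\<integral>s. heat_kernel d s r \<partial>jumps) = (\<integral>s. indicator {0<..} s * m s * heat_kernel d s r \<partial>lborel)"
    by (rule integral_jumps) measurable
  also have "\<dots> \<le> (\<integral>s. c * g s + m A * (indicator {A..} s * s powr (- k)) \<partial>lborel)"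
  proof (rule integral_mono)
    have "integrable jumps (\<lambda>s. heat_kernel d s r)" using d r by (intro integrable_heat_kernel) auto
    then show "integrable lborel (\<lambda>s. indicator {0<..} s * m s * heat_kernel d s r)"
      by (subst (asm) integrable_jumps) auto
    show "integrable lborel (\<lambda>s. c * g s + m A * (indicator {A..} s * s powr (- k)))"
      using g tail by (intro Bochner_Integration.integrable_add integrable_mult_right)
        (auto simp: has_bochner_integral_iff)
    fix s :: real
    consider "s \<le> 0" | "0 < s" "s < A" | "0 < s" "A \<le> s" by linarith
    then show "indicator {0<..} s * m s * heat_kernel d s r \<le> c * g s + m A * (indicator {A..} s * s powr (- k))"
    proof cases
      case 1
      then show ?thesis using A by (simp add: g_def)
    next
      case 2
      have "s \<le> r\<^sup>2" using 2 mult_right_mono[OF \<delta>(2), of "r\<^sup>2"] by (simp add: A_def)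
      then have "exp 0 \<le> exp (1 + - (1 / r\<^sup>2) * s)" using r2 by simp
      then have one: "1 \<le> exp 1 * exp (- (1 / r\<^sup>2) * s)" by (simp only: exp_add exp_zero)
      have "heat_kernel d s r \<le> \<epsilon> * r powr (- real d - 2) * s * 1"
        using low[of s] 2 by (simp add: A_def)
      also have "\<dots> \<le> \<epsilon> * r powr (- real d - 2) * s * (exp 1 * exp (- (1 / r\<^sup>2) * s))"
        using one \<epsilon> 2 by (intro mult_left_mono) auto
      finally have "m s * heat_kernel d s r \<le> m s * (\<epsilon> * r powr (- real d - 2) * s * (exp 1 * exp (- (1 / r\<^sup>2) * s)))"
        using m_nonneg[of s] 2 by (intro mult_left_mono) auto
      then show ?thesis using 2 by (simp add: g_def c_def mult_ac)
    next
      case 3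
      have "m s * heat_kernel d s r \<le> m A * s powr (- k)"
        using heat_kernel_le_powr[of s d r] 3 m_noninc[OF A 3(2)] m_nonneg[OF A]
        by (intro mult_mono) (auto simp: k_def heat_kernel_nonneg)
      moreover have "0 \<le> c * g s"
        using c m_nonneg[of s] 3 by (simp add: g_def)
      ultimately show ?thesis using 3 by simp
    qed
  qed
  also have "\<dots> = c * dlexp (1 / r\<^sup>2) + m A * (A powr (1 - k) / (k - 1))"
    using g tail by (simp add: has_bochner_integral_iff)
  finally show ?thesis by (simp add: c_def A_def k_def)
qed

text \<open>Only \<open>s\<close> between \<open>A = \<delta> / (2 * u)\<close> and
  \<open>2 * A\<close> is kept. There \<open>m s\<close> is at least
  \<open>m (\<delta> / u)\<close>, and the exponential difference
  \<open>exp (- u * s) * (1 - exp (- u * s))\<close> is bounded below factor by factor. One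
  \<open>A\<close> comes from \<open>s\<close>, the other from the length of the interval.\<close>

lemma dlexp_decrement_ge:
  assumes u: "0 < u" and \<delta>: "0 < \<delta>"
  shows "m (\<delta> / u) * (exp (- \<delta>) * (1 - exp (- \<delta> / 2))) * (\<delta> / (2 * u))\<^sup>2 \<le> dlexp u - dlexp (2 * u)"
proof -
  define A where "A = \<delta> / (2 * u)"
  have A: "0 < A" "u * A = \<delta> / 2" "\<delta> / u = 2 * A" using u \<delta> by (auto simp: A_def)
  define c where "c = m (2 * A) * (exp (- \<delta>) * (1 - exp (- \<delta> / 2))) * A"
  let ?g = "\<lambda>u s. indicator {0<..} s * m s * (s * exp (- u * s))"
  have "c * A = (\<integral>s. c * indicator {A..2 * A} s \<partial>lborel)"
    using A by simp
  also have "\<dots> \<le> (\<integral>s. ?g u s - ?g (2 * u) s \<partial>lborel)"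
  proof (rule integral_mono)
    show "integrable lborel (\<lambda>s. c * indicator {A..2 * A} s)"
      using A by (intro integrable_mult_right integrable_real_indicator) auto
    show "integrable lborel (\<lambda>s. ?g u s - ?g (2 * u) s)"
      using u by (intro Bochner_Integration.integrable_diff integrable_lborel_mult_exp) auto
    fix s :: real
    have e: "exp (- u * s) - exp (- (2 * u) * s) = exp (- u * s) * (1 - exp (- u * s))"
      by (simp add: algebra_simps flip: exp_add)
    have eq: "?g u s - ?g (2 * u) s = indicator {0<..} s * (m s * (exp (- u * s) * (1 - exp (- u * s))) * s)"
      unfolding e[symmetric] by (simp add: algebra_simps)
    show "c * indicator {A..2 * A} s \<le> ?g u s - ?g (2 * u) s"
    proof (cases "s \<in> {A..2 * A}")
      case True
      have "u * A \<le> u * s" "u * s \<le> u * (2 * A)" using True u by (auto intro: mult_left_mono)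
      then have us: "\<delta> / 2 \<le> u * s" "u * s \<le> \<delta>" using A by auto
      have "c \<le> m s * (exp (- u * s) * (1 - exp (- u * s))) * s"
        unfolding c_def using True A us \<delta> m_noninc[of s "2 * A"] m_nonneg[of s]
        by (intro mult_mono) auto
      then show ?thesis unfolding eq using True A by simp
    next
      case False
      have "0 \<le> indicator {0<..} s * (m s * (exp (- u * s) * (1 - exp (- u * s))) * s)"
        using m_nonneg[of s] u by (auto split: split_indicator)
      then show ?thesis unfolding eq using False by simp
    qed
  qed
  also have "\<dots> = dlexp u - dlexp (2 * u)"
    unfolding dlexp_eq_lborel using u
    by (intro Bochner_Integration.integral_diff integrable_lborel_mult_exp) auto
  finally show ?thesis
    unfolding c_def A(3) by (simp add: A_def power2_eq_square mult_ac)
qed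

lemma WUSC_of_levy_density_ge:
  assumes d: "3 \<le> d" and C: "0 < C" and \<theta>: "0 < \<theta>"
    and ge: "\<And>r. 0 < r \<Longrightarrow> r < 1 / \<theta> \<Longrightarrow>
      C * r powr (- real d - 2) * dlexp (1 / r\<^sup>2) \<le> (\<integral>s. heat_kernel d s r \<partial>jumps)"
  shows "\<exists>\<alpha>>0. \<exists>c\<ge>1. WUSC dlexp (- \<alpha>) (\<theta>\<^sup>2) c"
proof -
  define k where "k = real d / 2"
  have k: "1 < k" using d by (simp add: k_def)
  \<comment> \<open>Chosen so that the small-jump term in \<open>levy_density_le\<close> is exactly
    half of the assumed lower bound and can be subtracted from it.\<close>
  define \<epsilon> where "\<epsilon> = C * exp (- 1) / 2"
  have \<epsilon>: "0 < \<epsilon>" "\<epsilon> * exp 1 = C / 2" using C by (auto simp: \<epsilon>_def exp_minus)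
  obtain \<delta> where \<delta>: "0 < \<delta>" "\<delta> \<le> 1" and low:
    "\<And>s r. 0 < r \<Longrightarrow> 0 < s \<Longrightarrow> s < \<delta> * r\<^sup>2 \<Longrightarrow> heat_kernel d s r \<le> \<epsilon> * r powr (- real d - 2) * s"
    using heat_kernel_low[OF \<epsilon>(1)] by blast
  define c1 where "c1 = C / 2 * (k - 1) * \<delta> powr (k - 1)"
  have c1: "0 < c1" using C k \<delta> by (simp add: c1_def)
  \<comment> \<open>The radius is \<open>r = 1 / sqrt u\<close>, so \<open>r < 1 / \<theta>\<close>
    becomes \<open>u > \<theta>\<^sup>2\<close>. The constant \<open>c1\<close> comes from solving
    the remaining half of the inequality for \<open>m (\<delta> / u)\<close>.\<close>
  have m_ge: "c1 * u\<^sup>2 * dlexp u \<le> m (\<delta> / u)" if u: "\<theta>\<^sup>2 < u" for u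
  proof -
    have u0: "0 < u" using u by (smt (verit) zero_le_power2)
    define r where "r = 1 / sqrt u"
    have r: "0 < r" "r\<^sup>2 = 1 / u" using u0 by (auto simp: r_def power_divide)
    have "\<theta> < sqrt u" using u \<theta> by (simp add: real_less_rsqrt)
    then have "r < 1 / \<theta>" using \<theta> u0 by (simp add: r_def field_simps)
    then have "C * r powr (- real d - 2) * dlexp u \<le> (\<integral>s. heat_kernel d s r \<partial>jumps)"
      using ge[OF r(1)] r(2) by simp
    also have "\<dots> \<le> C / 2 * r powr (- real d - 2) * dlexp u + m (\<delta> / u) * ((\<delta> / u) powr (1 - k) / (k - 1))"
      using levy_density_le[OF d r(1) \<delta> low] r \<epsilon> by (simp add: k_def)
    finally have "C / 2 * r powr (- real d - 2) * dlexp u \<le> m (\<delta> / u) * ((\<delta> / u) powr (1 - k) / (k - 1))"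
      by linarith
    also have "r powr (- real d - 2) = u powr k * u"
      unfolding powr_minus_nat_add_2[OF r(1)] r(2) using u0
      by (simp add: k_def powr_divide powr_minus_divide)
    also have "u powr k * u = u powr (k - 1) * u\<^sup>2"
      using u0 by (simp add: powr_diff power2_eq_square)
    also have "(\<delta> / u) powr (1 - k) = u powr (k - 1) / \<delta> powr (k - 1)"
      using u0 \<delta> powr_minus[of u "k - 1"] powr_minus[of \<delta> "k - 1"] by (simp add: powr_divide field_simps)
    finally have "(k - 1) * \<delta> powr (k - 1) * (C / 2 * (u powr (k - 1) * u\<^sup>2) * dlexp u)
      \<le> (k - 1) * \<delta> powr (k - 1) * (m (\<delta> / u) * (u powr (k - 1) / \<delta> powr (k - 1) / (k - 1)))"
      using k by (intro mult_left_mono) auto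
    also have "\<dots> = u powr (k - 1) * m (\<delta> / u)"
      using k \<delta> by simp
    finally have "u powr (k - 1) * (c1 * u\<^sup>2 * dlexp u) \<le> u powr (k - 1) * m (\<delta> / u)"
      by (simp add: c1_def mult_ac)
    then show ?thesis using u0 by simp
  qed
  \<comment> \<open>The fraction of \<open>dlexp u\<close> lost on doubling \<open>u\<close>: the
    \<open>u\<^sup>2\<close> in \<open>m_ge\<close> cancels the denominator of
    \<open>(\<delta> / (2 * u))\<^sup>2\<close>.\<close>
  define \<kappa> where "\<kappa> = c1 * (exp (- \<delta>) * (1 - exp (- \<delta> / 2))) * (\<delta> / 2)\<^sup>2"
  have \<kappa>: "0 < \<kappa>" using c1 \<delta> by (simp add: \<kappa>_def)
  \<comment> \<open>The maximum keeps \<open>q\<close> positive without an upper bound on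
    \<open>\<kappa>\<close>.\<close>
  define q where "q = max (1 / 2) (1 - \<kappa>)"
  show ?thesis
  proof (rule WUSC_of_halving[where q = q])
    show "0 < q" "q < 1" using \<kappa> by (auto simp: q_def)
    fix u assume u: "\<theta>\<^sup>2 < u"
    have u0: "0 < u" using u by (smt (verit) zero_le_power2)
    have "\<kappa> * dlexp u = c1 * u\<^sup>2 * dlexp u * (exp (- \<delta>) * (1 - exp (- \<delta> / 2))) * (\<delta> / (2 * u))\<^sup>2"
      using u0 by (simp add: \<kappa>_def power_divide power_mult_distrib)
    also have "\<dots> \<le> m (\<delta> / u) * (exp (- \<delta>) * (1 - exp (- \<delta> / 2))) * (\<delta> / (2 * u))\<^sup>2"
      using m_ge[OF u] \<delta> by (intro mult_right_mono) auto
    also have "\<dots> \<le> dlexp u - dlexp (2 * u)"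
      by (rule dlexp_decrement_ge[OF u0 \<delta>(1)])
    finally have "dlexp (2 * u) \<le> (1 - \<kappa>) * dlexp u" by (simp add: algebra_simps)
    also have "\<dots> \<le> q * dlexp u" by (intro mult_right_mono dlexp_nonneg) (simp add: q_def)
    finally show "dlexp (2 * u) \<le> q * dlexp u" .
  qed (auto simp: dlexp_antimono dlexp_nonneg)
qed

end

section \<open>The equivalence\<close>

text \<open>The integral in \<open>sbm_density\<close> omits \<open>s = 0\<close>, where
  \<open>eta t\<close> may have an atom. Including it changes nothing, because
  \<open>heat_kernel d 0 r\<close> is 0 by the convention for \<open>powr\<close> at 0.\<close>

lemma (in subordinator_laws) sbm_density_eq:
  assumes "t > 0"
  shows "sbm_density d eta t x = (\<integral>s. heat_kernel d s (norm x) \<partial>eta t)"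
proof -
  interpret H: half_line_levy "eta t" by (rule half_line_levy_eta[OF assms])
  have "AE s in eta t. indicator {0<..} s *\<^sub>R heat_kernel d s (norm x) = heat_kernel d s (norm x)"
    using H.AE_nonneg by eventually_elim (auto split: split_indicator simp: not_less)
  then show ?thesis
    unfolding sbm_density_def set_lebesgue_integral_def
    by (intro integral_cong_AE) measurable
qed

theorem mainTheorem19:
  fixes m :: "real \<Rightarrow> real"
    and eta :: "real \<Rightarrow> real measure"
  defines "\<phi> \<equiv> bernstein_phi m"
    and "d \<equiv> DIM('a::euclidean_space)"
  assumes dim: "d \<ge> 3"
    and m_meas: "m \<in> borel_measurable borel"
    and m_nonneg: "\<And>s. s > 0 \<Longrightarrow> m s \<ge> 0"
    and m_noninc: "\<And>s s'. 0 < s \<Longrightarrow> s \<le> s' \<Longrightarrow> m s' \<le> m s"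
    and m_levy: "(\<integral>\<^sup>+ s\<in>{0<..}. ennreal (min 1 s * m s) \<partial>lborel) < \<infinity>"
    and eta_prob: "\<And>t. t > 0 \<Longrightarrow> prob_space (eta t)"
    and eta_sets: "\<And>t. t > 0 \<Longrightarrow> sets (eta t) = sets borel"
    and eta_supp: "\<And>t. t > 0 \<Longrightarrow> emeasure (eta t) {..<0} = 0"
    and eta_laplace: "\<And>t u. t > 0 \<Longrightarrow> u \<ge> 0 \<Longrightarrow>
        (\<integral>s. exp (- u * s) \<partial>eta t) = exp (- t * \<phi> u)"
  shows
    "((\<exists>\<theta>\<ge>0. \<exists>\<alpha>>0. \<exists>c\<ge>1. WUSC (deriv \<phi>) (- \<alpha>) \<theta> c)
      \<longleftrightarrow>
      (\<exists>C>0. \<exists>\<theta>>0. \<forall>t>0. \<forall>x::'a.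
         t * \<phi> (norm x powr (-2)) \<le> 1 \<and> 0 < norm x \<and> norm x < 1 / \<theta> \<longrightarrow>
         sbm_density d eta t x \<ge> C * t * norm x powr (- real d - 2) * deriv \<phi> (norm x powr (-2))))
     \<and>
     ((\<exists>C>0. \<exists>\<theta>>0. \<forall>t>0. \<forall>x::'a.
         t * \<phi> (norm x powr (-2)) \<le> 1 \<and> 0 < norm x \<and> norm x < 1 / \<theta> \<longrightarrow>
         sbm_density d eta t x \<ge> C * t * norm x powr (- real d - 2) * deriv \<phi> (norm x powr (-2)))
      \<longleftrightarrow>
      (\<exists>C>0. \<exists>\<theta>>0. \<forall>x::'a. 0 < norm x \<and> norm x < 1 / \<theta> \<longrightarrow>
         sbm_levy_density d m x \<ge> C * norm x powr (- real d - 2) * deriv \<phi> (norm x powr (-2))))"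
proof -
  interpret D: decreasing_levy_density m
    by standard (fact m_meas m_nonneg m_noninc m_levy)+
  have \<phi>: "\<phi> = D.lexp" unfolding \<phi>_def by (rule D.bernstein_phi_eq_lexp)
  interpret S: subordinator_laws D.jumps eta
    by (intro subordinator_laws.intro subordinator_laws_axioms.intro D.half_line_levy_axioms)
      (fact eta_prob eta_sets eta_supp eta_laplace[unfolded \<phi>])+
  have d0: "0 < d" using dim by simp
  have pw: "r powr (- 2) = 1 / r\<^sup>2" if "0 < r" for r :: real
    using that by (simp add: powr_minus_divide powr_numeral)
  have dphi: "deriv \<phi> (r powr (- 2)) = D.dlexp (1 / r\<^sup>2)" if "0 < r" for r :: real
    using that by (simp add: pw \<phi> D.deriv_lexp)
  \<comment> \<open>The functions \<open>deriv \<phi>\<close> and \<open>D.dlexp\<close> are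
    identified at positive arguments only, and \<open>0 \<le> \<theta>\<close> ensures that
    \<open>WUSC\<close> evaluates them nowhere else.\<close>
  have WUSC_eq: "WUSC (deriv \<phi>) b \<theta> c \<longleftrightarrow> WUSC D.dlexp b \<theta> c" if "0 \<le> \<theta>" for b \<theta> c
  proof -
    have "deriv \<phi> (l * u) = D.dlexp (l * u)" "deriv \<phi> u = D.dlexp u" if "1 \<le> l" "\<theta> < u" for l u
      using that \<open>0 \<le> \<theta>\<close> by (auto simp: \<phi> D.deriv_lexp)
    then show ?thesis unfolding WUSC_def by (metis (no_types, lifting))
  qed
  let ?i = "\<exists>\<theta>\<ge>0. \<exists>\<alpha>>0. \<exists>c\<ge>1. WUSC (deriv \<phi>) (- \<alpha>) \<theta> c"
  let ?ii = "\<exists>C>0. \<exists>\<theta>>0. \<forall>t>0. \<forall>x::'a.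
         t * \<phi> (norm x powr (-2)) \<le> 1 \<and> 0 < norm x \<and> norm x < 1 / \<theta> \<longrightarrow>
         sbm_density d eta t x \<ge> C * t * norm x powr (- real d - 2) * deriv \<phi> (norm x powr (-2))"
  let ?iii = "\<exists>C>0. \<exists>\<theta>>0. \<forall>x::'a. 0 < norm x \<and> norm x < 1 / \<theta> \<longrightarrow>
         sbm_levy_density d m x \<ge> C * norm x powr (- real d - 2) * deriv \<phi> (norm x powr (-2))"
  have "?ii" if "?i"
  proof -
    from that obtain \<theta> \<alpha> c where \<theta>: "0 \<le> \<theta>" and \<alpha>: "0 < \<alpha>" and c: "1 \<le> c"
      and W: "WUSC D.dlexp (- \<alpha>) \<theta> c" using WUSC_eq by blast
    obtain a where a: "0 < a" "a \<le> 1"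
      and low: "\<And>u. \<theta> < u \<Longrightarrow> D.dlexp (u / a) \<le> exp (- 2) / 4 * D.dlexp u"
      using WUSC_shrink[OF W \<alpha> c, of "exp (- 2) / 4"] D.dlexp_nonneg by auto
    define b :: real where "b = 2 * (1 + ln 16)"
    have b: "0 < b" unfolding b_def by (simp add: add_pos_pos)
    define C where "C = (4 * pi * b) powr (- real d / 2) * exp (- 1 / (4 * a)) / b * (exp (- 1) / 2)"
    show ?thesis
    proof (intro exI conjI allI impI)
      show "0 < C" using b by (simp add: C_def)
      \<comment> \<open>Adding 1 makes the threshold positive when \<open>\<theta> = 0\<close> and
        gives \<open>(\<theta> + 1)\<^sup>2 \<ge> \<theta> + 1\<close>, so that
        \<open>1 / r\<^sup>2\<close> exceeds \<open>\<theta>\<close>.\<close>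
      show "0 < \<theta> + 1" using \<theta> by simp
      fix t :: real and x :: 'a
      assume t: "0 < t"
        and x: "t * \<phi> (norm x powr - 2) \<le> 1 \<and> 0 < norm x \<and> norm x < 1 / (\<theta> + 1)"
      define r where "r = norm x"
      have r: "0 < r" "t * D.lexp (1 / r\<^sup>2) \<le> 1" "\<theta> + 1 < 1 / r"
        using x \<theta> by (auto simp: r_def \<phi> pw field_simps)
      have "\<theta> + 1 \<le> (\<theta> + 1)\<^sup>2" using \<theta> by (simp add: power2_eq_square)
      also have "\<dots> < (1 / r)\<^sup>2" using r \<theta> by (intro power_strict_mono) auto
      finally have u: "\<theta> < 1 / r\<^sup>2" by (simp add: power_divide)
      have "C * t * r powr (- real d - 2) * D.dlexp (1 / r\<^sup>2) \<le> (\<integral>s. heat_kernel d s r \<partial>eta t)"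
        unfolding C_def
        using low[OF u] D.dlexp_half_le[of "1 / r\<^sup>2"] r
        by (intro S.heat_kernel_mean_ge d0 t a b_def) (auto simp: mult.commute)
      then show "C * t * norm x powr (- real d - 2) * deriv \<phi> (norm x powr - 2) \<le> sbm_density d eta t x"
        using r(1) by (simp add: dphi S.sbm_density_eq[OF t] r_def)
    qed
  qed
  moreover have "?iii" if "?ii"
  proof -
    from that obtain C \<theta> where C: "0 < C" and \<theta>: "0 < \<theta>"
      and ge: "\<And>t (x::'a). 0 < t \<Longrightarrow> t * \<phi> (norm x powr (-2)) \<le> 1 \<Longrightarrow> 0 < norm x \<Longrightarrow> norm x < 1 / \<theta> \<Longrightarrow>
         sbm_density d eta t x \<ge> C * t * norm x powr (- real d - 2) * deriv \<phi> (norm x powr (-2))"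
      by blast
    show ?thesis
    proof (intro exI conjI allI impI)
      show "0 < C" "0 < \<theta>" by fact+
      fix x :: 'a assume x: "0 < norm x \<and> norm x < 1 / \<theta>"
      define L where "L = \<phi> (norm x powr (-2))"
      \<comment> \<open>For fixed \<open>x\<close> the constraint \<open>t * L \<le> 1\<close> holds
        for all small \<open>t\<close>, so the bound in (ii) can be divided by \<open>t\<close> and
        passed to the limit.\<close>
      have "((\<lambda>t. t * L) \<longlongrightarrow> 0) (at_right 0)"
        by (auto intro!: tendsto_eq_intros)
      then have "\<forall>\<^sub>F t in at_right 0. t * L < 1"
        by (rule order_tendstoD) simp
      moreover have "\<forall>\<^sub>F t in at_right 0. (0::real) < t"
        by (simp add: eventually_at_right_less)
      ultimately have "\<forall>\<^sub>F t in at_right 0. C * norm x powr (- real d - 2) * deriv \<phi> (norm x powr (-2))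
         \<le> (\<integral>s. heat_kernel d s (norm x) \<partial>eta t) / t"
      proof eventually_elim
        case (elim t)
        then show ?case
          using ge[of t x] x by (simp add: S.sbm_density_eq L_def pos_le_divide_eq mult_ac)
      qed
      then have "C * norm x powr (- real d - 2) * deriv \<phi> (norm x powr (-2)) \<le> (\<integral>s. heat_kernel d s (norm x) \<partial>D.jumps)"
        using x by (intro tendsto_lowerbound[OF S.tendsto_heat_kernel[OF d0]]) auto
      then show "C * norm x powr (- real d - 2) * deriv \<phi> (norm x powr - 2) \<le> sbm_levy_density d m x"
        by (simp add: D.sbm_levy_density_eq)
    qed
  qed
  moreover have "?i" if "?iii"
  proof -
    from that obtain C \<theta> where C: "0 < C" and \<theta>: "0 < \<theta>"
      and ge: "\<And>x::'a. 0 < norm x \<Longrightarrow> norm x < 1 / \<theta> \<Longrightarrow>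
         sbm_levy_density d m x \<ge> C * norm x powr (- real d - 2) * deriv \<phi> (norm x powr (-2))"
      by blast
    have "\<exists>\<alpha>>0. \<exists>c\<ge>1. WUSC D.dlexp (- \<alpha>) (\<theta>\<^sup>2) c"
    proof (rule D.WUSC_of_levy_density_ge[OF dim C \<theta>])
      fix r :: real assume r: "0 < r" "r < 1 / \<theta>"
      \<comment> \<open>Passing from vectors to radii requires every \<open>r > 0\<close> to be the
        norm of some vector.\<close>
      obtain x :: 'a where x: "norm x = r" using vector_choose_size[of r] r by auto
      show "C * r powr (- real d - 2) * D.dlexp (1 / r\<^sup>2) \<le> (\<integral>s. heat_kernel d s r \<partial>D.jumps)"
        using ge[of x] r by (simp add: x dphi D.sbm_levy_density_eq)
    qed
    moreover have "0 \<le> \<theta>\<^sup>2" by simp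
    ultimately show ?thesis using WUSC_eq by meson
  qed
  ultimately show ?thesis by blast
qed

end
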